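(* If a trajectory $(m,w,f)$ of the continuous dynamics of the Petri net with free choice and priority routing converges towards a stationary solution $(m^\infty,w^\infty,f^\infty)$, if for this trajectory there exists a policy $\pi$ that reaches the infimum in $f(t)=\inf_{\pi':\,S_{\pi'}w(t)=0}(C^-_{\pi'})^{-1}S_{\pi'}(m(t)/\tau)$ at any time $t$, and if $0$ is a semi-simple eigenvalue of the matrix $S_\pi C^+-C^-_\pi$ associated with this policy, then $f^\infty$ is uniquely determined by the initial marking.
   Context: Net. A Petri net consists of a finite set $\mathcal P$ of places, a finite set $\mathcal Q$ of transitions, and valuations $a^+_{qp}\in\mathbb N$ of the arc from transition $q$ to place $p$ and $a^-_{qp}\in\mathbb N$ of the arc from place $p$ to transition $q$ (value $0$ meaning no arc). The net is pure: for each $(q,p)$ at least one of $a^+_{qp},a^-_{qp}$ is $0$. $C^+,C^-$ are the $\mathcal P\times\mathcal Q$ matrices with $(p,q)$ entries $a^+_{qp}$, $a^-_{qp}$. Write $q^{\mathrm{in}}=\{p: a^-_{qp}>0\}$ and $p^{\mathrm{out}}=\{q:a^-_{qp}>0\}$. The net is strongly connected and autonomous; in particular each transition has at least one upstream place. Every place is either free choice (either $q^{\mathrm{in}}=\{p\}$ for all $q\in p^{\mathrm{out}}$, or $|p^{\mathrm{out}}|=1$) or subject to priority. $\mathcal P_{\mathsf{conflict}}$ is the set of free choice places with at least two output transitions; $\mathcal P_{\mathsf{priority}}$ is the set of places subject to priority; $\mathcal Q_{\mathsf{sync}}$ is the set of transitions all of whose upstream places $p$ satisfy $|p^{\mathrm{out}}|=1$.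 Each $p\in\mathcal P_{\mathsf{priority}}$ has exactly two output transitions, $q_+=q_+(p)$ (with priority) and $q_-=q_-(p)$; each transition has at most one upstream place in $\mathcal P_{\mathsf{priority}}$. Each place has a time constant $\tau_p>0$, and for $p\in\mathcal P_{\mathsf{conflict}}$, $q\in p^{\mathrm{out}}$ there are weights $\mu_{qp}>0$ with $\sum_{q\in p^{\mathrm{out}}}\mu_{qp}=1$. Denote by $m/\tau$ the vector $(m_p/\tau_p)_{p\in\mathcal P}$. Dynamics. A trajectory of the continuous dynamics is a triple $(m,w,f)$ of functions of $t\ge0$ with values in $\mathbb R_{\ge0}^{\mathcal P},\mathbb R_{\ge0}^{\mathcal P},\mathbb R_{\ge0}^{\mathcal Q}$, with $m,w$ locally absolutely continuous and $f$ locally integrable, such that $\dot m=C^+f-m/\tau$ and $\dot w=m/\tau-C^-f$ for almost every $t$, and for every $t$: each transition $q$ has an upstream place $p$ with $w_p(t)=0$, and (a minimum over the empty set being $+\infty$) - for $q\in\mathcal Q_{\mathsf{sync}}$: $f_q(t)=\min_{p\in q^{\mathrm{in}},w_p(t)=0}\frac{m_p(t)}{a^-_{qp}\tau_p}$; - for $p\in\mathcal P_{\mathsf{conflict}}$, $q\in p^{\mathrm{out}}$: $a^-_{qp}f_q(t)=\mu_{qp}\frac{m_p(t)}{\tau_p}$; - for $p\in\mathcal P_{\mathsf{priority}}$: $f_{q_+}(t)=\min_{r\in q_+^{\mathrm{in}},w_r(t)=0}\frac{m_r(t)}{a^-_{q_+r}\tau_r}$, and $f_{q_-}(t)=\min_{r\in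 q_-^{\mathrm{in}}\setminus\{p\},w_r(t)=0}\frac{m_r(t)}{a^-_{q_-r}\tau_r}$ if $w_p(t)\ne0$, while if $w_p(t)=0$, $f_{q_-}(t)=\min\Big(\frac{m_p(t)}{a^-_{q_-p}\tau_p}-\frac{a^-_{q_+p}}{a^-_{q_-p}}f_{q_+}(t),\ \min_{r\in q_-^{\mathrm{in}}\setminus\{p\},w_r(t)=0}\frac{m_r(t)}{a^-_{q_-r}\tau_r}\Big)$. Here $m_p(t)$ is the quantity of tokens under processing in place $p$, $w_p(t)$ is the quantity of waiting tokens, and the marking of $p$ is $M_p(t)=m_p(t)+w_p(t)$; the initial marking is the marking at time $0$. A stationary solution is a trajectory on $[0,\infty)$ with every $m_p$ constant and every $w_p$ affine; its flow is then constant in time. Convergence of $(m,w,f)$ towards $(m^\infty,w^\infty,f^\infty)$ means $m(t)\to m^\infty$, $f(t)\to f^\infty$ and $w(t)-w^\infty(t)\to0$ as $t\to\infty$. Policies. A policy $\pi$ maps each transition $q$ to one of its upstream places $p_\pi(q)\in q^{\mathrm{in}}$. $S_\pi$ is the $\mathcal Q\times\mathcal P$ matrix with $(S_\pi)_{qp}=1$ if $p=p_\pi(q)$ and $0$ otherwise. $C^-_\pi$ is the (invertible) $\mathcal Q\times\mathcal Q$ matrix such that, with $p=p_\pi(q)$: $(C^-_\pi f)_q=a^-_{qp}f_q$ if $p\notin\mathcal P_{\mathsf{conflict}}\cup\mathcal P_{\mathsf{priority}}$; $(C^-_\pi f)_q=\frac{a^-_{qp}}{\mu_{qp}}f_q$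 if $p\in\mathcal P_{\mathsf{conflict}}$; $(C^-_\pi f)_q=a^-_{qp}f_q$ if $p\in\mathcal P_{\mathsf{priority}}$ and $q=q_+(p)$; $(C^-_\pi f)_q=a^-_{qp}f_q+a^-_{q_+p}f_{q_+}$ if $p\in\mathcal P_{\mathsf{priority}}$, $q=q_-(p)$ and $q_+=q_+(p)$. With this notation the flow along a trajectory is written $f(t)=\inf_{\pi:\,S_\pi w(t)=0}(C^-_\pi)^{-1}S_\pi(m(t)/\tau)$, the infimum being for the componentwise order on $\mathbb R^{\mathcal Q}$; a policy $\pi$ reaches the infimum at time $t$ if $S_\pi w(t)=0$ and $f(t)=(C^-_\pi)^{-1}S_\pi(m(t)/\tau)$. An eigenvalue of a matrix is semi-simple if the dimension of its eigenspace equals its algebraic multiplicity. *)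

theory Defs
  imports "HOL-Analysis.Analysis" "HOL-Computational_Algebra.Polynomial"
begin

section \<open>Petri nets with free choice and priority routing\<close>

text \<open>
  Places and transitions are the elements of the finite types \<open>'p\<close> and \<open>'q\<close>.
  \<open>a_plus N q p\<close> and \<open>a_minus N q p\<close> are the valuations of the arcs \<open>q \<rightarrow> p\<close> and \<open>p \<rightarrow> q\<close>.
  The values \<open>mu N q p\<close> matter only when \<open>p\<close> is a conflict place with output \<open>q\<close>, and
  \<open>q_plus N p\<close>, \<open>q_minus N p\<close> only when \<open>p\<close> is a priority place.
\<close>

record ('p, 'q) petri_net =
  a_plus :: "'q \<Rightarrow> 'p \<Rightarrow> nat"
  a_minus :: "'q \<Rightarrow> 'p \<Rightarrow> nat"
  tau :: "'p \<Rightarrow> real"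
  mu :: "'q \<Rightarrow> 'p \<Rightarrow> real"
  priority_places :: "'p set"
  q_plus :: "'p \<Rightarrow> 'q"
  q_minus :: "'p \<Rightarrow> 'q"

definition q_in :: "('p, 'q) petri_net \<Rightarrow> 'q \<Rightarrow> 'p set" where
  "q_in N q = {p. a_minus N q p > 0}"

definition p_out :: "('p, 'q) petri_net \<Rightarrow> 'p \<Rightarrow> 'q set" where
  "p_out N p = {q. a_minus N q p > 0}"

definition arcs :: "('p, 'q) petri_net \<Rightarrow> (('p + 'q) \<times> ('p + 'q)) set" where
  "arcs N = {(Inl p, Inr q) | p q. a_minus N q p > 0} \<union> {(Inr q, Inl p) | p q. a_plus N q p > 0}"

definition free_choice :: "('p, 'q) petri_net \<Rightarrow> 'p \<Rightarrow> bool" where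
  "free_choice N p \<longleftrightarrow> (\<forall>q \<in> p_out N p. q_in N q = {p}) \<or> card (p_out N p) = 1"

text \<open>
  Being subject to priority is part of the data of the net. A priority place is never a conflict
  place, even when the arcs around it happen to have the free choice shape.
\<close>

definition conflict_places :: "('p, 'q) petri_net \<Rightarrow> 'p set" where
  "conflict_places N = {p. p \<notin> priority_places N \<and> free_choice N p \<and> card (p_out N p) \<ge> 2}"

definition sync_transitions :: "('p, 'q) petri_net \<Rightarrow> 'q set" where
  "sync_transitions N = {q. \<forall>p \<in> q_in N q. card (p_out N p) = 1}"

definition priority_free_choice_net :: "('p::finite, 'q::finite) petri_net \<Rightarrow> bool" where
  "priority_free_choice_net N \<longleftrightarrow>
     (\<forall>q p. a_plus N q p = 0 \<or> a_minus N q p = 0) \<and>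
     (\<forall>x y. (x, y) \<in> (arcs N)\<^sup>*) \<and>
     (\<forall>q. q_in N q \<noteq> {}) \<and>
     (\<forall>p. p \<notin> priority_places N \<longrightarrow> free_choice N p) \<and>
     (\<forall>p \<in> priority_places N.
        q_plus N p \<noteq> q_minus N p \<and> p_out N p = {q_plus N p, q_minus N p}) \<and>
     (\<forall>q. card (q_in N q \<inter> priority_places N) \<le> 1) \<and>
     (\<forall>p. tau N p > 0) \<and>
     (\<forall>p \<in> conflict_places N.
        (\<forall>q \<in> p_out N p. mu N q p > 0) \<and> (\<Sum>q \<in> p_out N p. mu N q p) = 1)"

definition C_plus :: "('p::finite, 'q::finite) petri_net \<Rightarrow> real^'q^'p" where
  "C_plus N = (\<chi> p q. real (a_plus N q p))"

definition C_minus :: "('p::finite, 'q::finite) petri_net \<Rightarrow> real^'q^'p" where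
  "C_minus N = (\<chi> p q. real (a_minus N q p))"

definition over_tau :: "('p::finite, 'q::finite) petri_net \<Rightarrow> real^'p \<Rightarrow> real^'p" where
  "over_tau N m = (\<chi> p. m $ p / tau N p)"


section \<open>Continuous dynamics\<close>

text \<open>
  The usual epsilon-delta notion: the members of a division of a set of reals are finitely many
  compact intervals with pairwise disjoint interiors.
\<close>

definition absolutely_continuous_on_interval ::
  "real \<Rightarrow> real \<Rightarrow> (real \<Rightarrow> 'a::real_normed_vector) \<Rightarrow> bool" where
  "absolutely_continuous_on_interval a b g \<longleftrightarrow>
     (\<forall>\<epsilon>>0. \<exists>\<delta>>0. \<forall>D S. D division_of S \<longrightarrow> S \<subseteq> {a..b} \<longrightarrow> (\<Sum>K\<in>D. Sup K - Inf K) < \<delta> \<longrightarrow>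
        (\<Sum>K\<in>D. norm (g (Sup K) - g (Inf K))) < \<epsilon>)"

definition locally_absolutely_continuous :: "(real \<Rightarrow> 'a::real_normed_vector) \<Rightarrow> bool" where
  "locally_absolutely_continuous g \<longleftrightarrow> (\<forall>T\<ge>0. absolutely_continuous_on_interval 0 T g)"

definition locally_integrable :: "(real \<Rightarrow> 'a::euclidean_space) \<Rightarrow> bool" where
  "locally_integrable g \<longleftrightarrow> (\<forall>T\<ge>0. g absolutely_integrable_on {0..T})"

text \<open>
  The minimum over the places of \<open>X\<close> without waiting tokens; it is \<open>\<infinity>\<close> when there are none.
\<close>

definition min_rate ::
  "('p::finite, 'q::finite) petri_net \<Rightarrow> real^'p \<Rightarrow> real^'p \<Rightarrow> 'q \<Rightarrow> 'p set \<Rightarrow> ereal" where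
  "min_rate N m w q X =
     (INF r \<in> {r \<in> X. w $ r = 0}. ereal (m $ r / (real (a_minus N q r) * tau N r)))"

text \<open>The relations between the instantaneous values of \<open>m\<close>, \<open>w\<close> and \<open>f\<close>.\<close>

definition routing ::
  "('p::finite, 'q::finite) petri_net \<Rightarrow> real^'p \<Rightarrow> real^'p \<Rightarrow> real^'q \<Rightarrow> bool" where
  "routing N m w f \<longleftrightarrow>
     (\<forall>q. \<exists>p \<in> q_in N q. w $ p = 0) \<and>
     (\<forall>q \<in> sync_transitions N. ereal (f $ q) = min_rate N m w q (q_in N q)) \<and>
     (\<forall>p \<in> conflict_places N. \<forall>q \<in> p_out N p.
        real (a_minus N q p) * f $ q = mu N q p * (m $ p / tau N p)) \<and>
     (\<forall>p \<in> priority_places N.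
        let qp = q_plus N p; qm = q_minus N p;
            others = min_rate N m w qm (q_in N qm - {p})
        in ereal (f $ qp) = min_rate N m w qp (q_in N qp) \<and>
           (w $ p \<noteq> 0 \<longrightarrow> ereal (f $ qm) = others) \<and>
           (w $ p = 0 \<longrightarrow>
              ereal (f $ qm) =
                min (ereal (m $ p / (real (a_minus N qm p) * tau N p)
                       - real (a_minus N qp p) / real (a_minus N qm p) * f $ qp))
                    others))"

text \<open>Only the values of \<open>m\<close>, \<open>w\<close> and \<open>f\<close> at times \<open>t \<ge> 0\<close> are relevant.\<close>

definition trajectory ::
  "('p::finite, 'q::finite) petri_net \<Rightarrow>
   (real \<Rightarrow> real^'p) \<Rightarrow> (real \<Rightarrow> real^'p) \<Rightarrow> (real \<Rightarrow> real^'q) \<Rightarrow> bool" where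
  "trajectory N m w f \<longleftrightarrow>
     (\<forall>t\<ge>0. (\<forall>p. m t $ p \<ge> 0) \<and> (\<forall>p. w t $ p \<ge> 0) \<and> (\<forall>q. f t $ q \<ge> 0)) \<and>
     locally_absolutely_continuous m \<and>
     locally_absolutely_continuous w \<and>
     locally_integrable f \<and>
     (AE t in lebesgue_on {0..}.
        (m has_vector_derivative (C_plus N *v f t - over_tau N (m t))) (at t within {0..}) \<and>
        (w has_vector_derivative (over_tau N (m t) - C_minus N *v f t)) (at t within {0..})) \<and>
     (\<forall>t\<ge>0. routing N (m t) (w t) (f t))"

definition marking :: "(real \<Rightarrow> real^'p) \<Rightarrow> (real \<Rightarrow> real^'p) \<Rightarrow> real \<Rightarrow> real^'p::finite" where
  "marking m w t = m t + w t"

definition stationary_solution ::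
  "('p::finite, 'q::finite) petri_net \<Rightarrow>
   (real \<Rightarrow> real^'p) \<Rightarrow> (real \<Rightarrow> real^'p) \<Rightarrow> (real \<Rightarrow> real^'q) \<Rightarrow> bool" where
  "stationary_solution N m w f \<longleftrightarrow>
     trajectory N m w f \<and>
     (\<forall>p. \<exists>c. \<forall>t\<ge>0. m t $ p = c) \<and>
     (\<forall>p. \<exists>c d. \<forall>t\<ge>0. w t $ p = c + d * t)"

text \<open>
  The flow of a stationary solution is constant in time, so the values of \<open>m\<close> and \<open>f\<close> for a
  stationary solution are given by two vectors.
\<close>

definition converges_to_stationary ::
  "('p::finite, 'q::finite) petri_net \<Rightarrow>
   (real \<Rightarrow> real^'p) \<Rightarrow> (real \<Rightarrow> real^'p) \<Rightarrow> (real \<Rightarrow> real^'q) \<Rightarrow>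
   real^'p \<Rightarrow> (real \<Rightarrow> real^'p) \<Rightarrow> real^'q \<Rightarrow> bool" where
  "converges_to_stationary N m w f m_lim w_lim f_lim \<longleftrightarrow>
     stationary_solution N (\<lambda>t. m_lim) w_lim (\<lambda>t. f_lim) \<and>
     (m \<longlongrightarrow> m_lim) at_top \<and>
     (f \<longlongrightarrow> f_lim) at_top \<and>
     ((\<lambda>t. w t - w_lim t) \<longlongrightarrow> 0) at_top"


section \<open>Policies\<close>

definition policy :: "('p, 'q) petri_net \<Rightarrow> ('q \<Rightarrow> 'p) \<Rightarrow> bool" where
  "policy N \<pi> \<longleftrightarrow> (\<forall>q. \<pi> q \<in> q_in N q)"

definition S_policy :: "('q \<Rightarrow> 'p) \<Rightarrow> real^'p::finite^'q::finite" where
  "S_policy \<pi> = (\<chi> q p. if p = \<pi> q then 1 else 0)"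

definition C_minus_policy ::
  "('p::finite, 'q::finite) petri_net \<Rightarrow> ('q \<Rightarrow> 'p) \<Rightarrow> real^'q^'q" where
  "C_minus_policy N \<pi> =
     (\<chi> q q'. let p = \<pi> q in
        if q' = q then
          (if p \<in> conflict_places N then real (a_minus N q p) / mu N q p else real (a_minus N q p))
        else if p \<in> priority_places N \<and> q = q_minus N p \<and> q' = q_plus N p then
          real (a_minus N q' p)
        else 0)"

text \<open>
  The policy \<open>\<pi>\<close> reaches the infimum in
  \<open>f t = inf {(C_minus_policy N \<rho>)\<inverse> (S_policy \<rho>) (m t / \<tau>) | \<rho>. S_policy \<rho> (w t) = 0}\<close>.
\<close>

definition reaches_infimum ::
  "('p::finite, 'q::finite) petri_net \<Rightarrow> ('q \<Rightarrow> 'p) \<Rightarrow>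
   (real \<Rightarrow> real^'p) \<Rightarrow> (real \<Rightarrow> real^'p) \<Rightarrow> (real \<Rightarrow> real^'q) \<Rightarrow> real \<Rightarrow> bool" where
  "reaches_infimum N \<pi> m w f t \<longleftrightarrow>
     S_policy \<pi> *v w t = 0 \<and>
     f t = matrix_inv (C_minus_policy N \<pi>) *v (S_policy \<pi> *v over_tau N (m t))"


section \<open>Semi-simple eigenvalues\<close>

definition charpoly :: "'a::field^'n^'n \<Rightarrow> 'a poly" where
  "charpoly A = det (mat [:0, 1:] - map_matrix (\<lambda>a. [:a:]) A)"

definition semisimple_eigenvalue :: "'a::field^'n^'n \<Rightarrow> 'a \<Rightarrow> bool" where
  "semisimple_eigenvalue A c \<longleftrightarrow>
     (\<exists>v. v \<noteq> 0 \<and> A *v v = c *s v) \<and>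
     vec.dim {v. A *v v = c *s v} = order c (charpoly A)"

end

theory Submission
  imports Defs
begin

text \<open>
  A policy \<open>\<pi>\<close> that reaches the infimum at all times turns the piecewise linear dynamics into a linear
  differential equation. The places selected by \<open>\<pi>\<close> never hold waiting tokens, so their marking
  is the vector \<open>x = S_policy \<pi> *v m\<close> of their tokens under processing. Let \<open>T\<close> be the diagonal
  matrix of the time constants of these places. The flow is a function of \<open>x\<close>, namely
  \<open>f = J T\<inverse> x\<close> with \<open>J = matrix_inv (C_minus_policy N \<pi>)\<close>. Multiplying the equation for
  the derivative of \<open>m\<close> by \<open>S_policy \<pi>\<close> gives
  \<open>x' = (S_policy \<pi> C_plus J - 1) T\<inverse> x\<close> almost everywhere, which closes up in \<open>x\<close>. Its
  initial value \<open>x 0 = S_policy \<pi> *v (m 0 + w 0)\<close> depends on the initial marking alone, whichever way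
  that marking is split into \<open>m 0\<close> and \<open>w 0\<close>.

  Two trajectories that follow \<open>\<pi>\<close> from the same marking therefore have the same \<open>x\<close>, hence
  the same flow at every time (\<open>flow_determined_by_policy\<close>) and the same limit flow.

  As the equation holds only almost everywhere, uniqueness rests on absolute continuity:
  \<open>absolutely_continuous_increment_bound\<close> is the mean value inequality for a derivative that is
  bounded almost everywhere, and \<open>locally_absolutely_continuous_eq_zero\<close> deduces from it that the
  zero solution of a linear equation is the only one that starts at zero.
\<close>

section \<open>Mean value inequality for absolutely continuous functions\<close>

text \<open>
  The members of a division may share endpoints; their interiors are disjoint and have the same
  lengths.
\<close>

lemma sum_lengths_le_measure:
  fixes D :: "real set set"
  assumes D: "D division_of S" and S: "S \<subseteq> U" and U: "U \<in> lmeasurable"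
  shows "(\<Sum>K\<in>D. Sup K - Inf K) \<le> measure lebesgue U"
proof -
  note div = division_ofD[OF D]
  have interval: "\<exists>u v. K = {u..v} \<and> u \<le> v" if "K \<in> D" for K
    using div(3,4)[OF that] by fastforce
  have int_meas: "interior K \<in> lmeasurable" if "K \<in> D" for K
    using interval[OF that] by auto
  have "(\<Sum>K\<in>D. Sup K - Inf K) = (\<Sum>K\<in>D. measure lebesgue (interior K))"
    by (intro sum.cong refl) (use interval in fastforce)
  also have "\<dots> = measure lebesgue (\<Union>K\<in>D. interior K)"
    by (rule measure_UNION'[symmetric]) (use div(1,5) int_meas in \<open>auto simp: pairwise_def disjnt_def\<close>)
  also have "\<dots> \<le> measure lebesgue U"
  proof (rule measure_mono_fmeasurable)
    show "(\<Union>K\<in>D. interior K) \<subseteq> U"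
      using div(2) S interior_subset by blast
    show "(\<Union>K\<in>D. interior K) \<in> sets lebesgue"
      using div(1) int_meas by auto
  qed (rule U)
  finally show ?thesis .
qed

text \<open>
  Near a point where the derivative exists, increments over short intervals around the point obey
  the bound up to \<open>\<epsilon>\<close>. The remaining points lie in an open set of measure less than \<open>\<delta>\<close>,
  and absolute continuity makes the increments over disjoint intervals inside that set negligible.
  A tagged division fine for the corresponding gauge splits \<open>{a..b}\<close> into intervals of these two
  kinds.
\<close>

lemma absolutely_continuous_increment_bound:
  fixes g :: "real \<Rightarrow> 'a::real_normed_vector"
  assumes ac: "absolutely_continuous_on_interval a b g" and "a \<le> b" and "0 \<le> L"
    and Z: "negligible Z"
    and der: "\<And>t. t \<in> {a..b} - Z \<Longrightarrow>
       \<exists>D. (g has_vector_derivative D) (at t within {a..b}) \<and> norm D \<le> L"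
  shows "norm (g b - g a) \<le> L * (b - a)"
proof (rule field_le_epsilon)
  fix e :: real
  assume "e > 0"
  \<comment> \<open>The error is \<open>\<epsilon> * (b - a)\<close> from the good tags plus \<open>\<epsilon>\<close> from the bad ones.\<close>
  define \<epsilon> where "\<epsilon> = e / (b - a + 1)"
  have \<epsilon>: "\<epsilon> > 0" "\<epsilon> * (b - a + 1) = e"
    using \<open>e > 0\<close> \<open>a \<le> b\<close> by (auto simp: \<epsilon>_def)
  obtain \<delta> where "\<delta> > 0" and \<delta>: "\<And>D S. \<lbrakk>D division_of S; S \<subseteq> {a..b}; (\<Sum>K\<in>D. Sup K - Inf K) < \<delta>\<rbrakk>
      \<Longrightarrow> (\<Sum>K\<in>D. norm (g (Sup K) - g (Inf K))) < \<epsilon>"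
    using ac \<epsilon>(1) unfolding absolutely_continuous_on_interval_def by meson
  obtain U where U: "open U" "Z \<subseteq> U" "U \<in> lmeasurable" "measure lebesgue U < \<delta>"
  proof -
    obtain U where U: "open U" "Z \<subseteq> U" "U - Z \<in> lmeasurable" "emeasure lebesgue (U - Z) < ennreal \<delta>"
      using sets_lebesgue_outer_open[of Z \<delta>] Z \<open>\<delta> > 0\<close>
      by (metis fmeasurableD negligible_imp_measurable)
    have "U = (U - Z) \<union> Z" using U(2) by auto
    then have "U \<in> lmeasurable"
      using U(3) negligible_imp_measurable[OF Z] by (metis fmeasurable.Un)
    moreover have "measure lebesgue U = measure lebesgue (U - Z)"
      using Z \<open>U \<in> lmeasurable\<close> by (simp add: measure_Diff_null_set negligible_iff_null_sets fmeasurableD)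
    moreover have "measure lebesgue (U - Z) < \<delta>"
      using U(3,4) \<open>\<delta> > 0\<close> by (simp add: emeasure_eq_measure2 ennreal_less_iff)
    ultimately show thesis using that U(1,2) by simp
  qed
  have "\<exists>r>0. ball t r \<subseteq> U" if "t \<in> Z" for t
    using U that open_contains_ball by blast
  then obtain r where r: "\<And>t. t \<in> Z \<Longrightarrow> r t > 0 \<and> ball t (r t) \<subseteq> U"
    by metis
  have "\<exists>s>0. \<forall>u v. u \<in> {a..b} \<longrightarrow> v \<in> {a..b} \<longrightarrow> u \<le> t \<longrightarrow> t \<le> v \<longrightarrow> {u..v} \<subseteq> ball t s \<longrightarrow>
      norm (g v - g u) \<le> (L + \<epsilon>) * (v - u)" if "t \<in> {a..b} - Z" for t
  proof -
    obtain D where D: "(g has_vector_derivative D) (at t within {a..b})" "norm D \<le> L"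
      using der \<open>t \<in> {a..b} - Z\<close> by blast
    obtain s where "s > 0" and s: "\<And>y. \<lbrakk>y \<in> {a..b}; norm (y - t) < s\<rbrakk> \<Longrightarrow>
        norm (g y - g t - (y - t) *\<^sub>R D) \<le> \<epsilon> * norm (y - t)"
      using D(1) \<epsilon>(1) unfolding has_vector_derivative_def has_derivative_within_alt by metis
    have bound: "norm (g y - g t) \<le> (L + \<epsilon>) * \<bar>y - t\<bar>" if "y \<in> {a..b}" "\<bar>y - t\<bar> < s" for y
    proof -
      have "norm (g y - g t) \<le> norm (g y - g t - (y - t) *\<^sub>R D) + norm ((y - t) *\<^sub>R D)"
        by (metis diff_add_cancel norm_triangle_ineq)
      also have "\<dots> \<le> \<epsilon> * \<bar>y - t\<bar> + \<bar>y - t\<bar> * L"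
        using s[of y] that D(2) by (intro add_mono) (auto intro: mult_left_mono)
      finally show ?thesis by (simp add: algebra_simps)
    qed
    have "norm (g v - g u) \<le> (L + \<epsilon>) * (v - u)"
      if "u \<in> {a..b}" "v \<in> {a..b}" "u \<le> t" "t \<le> v" "{u..v} \<subseteq> ball t s" for u v
    proof -
      have "u \<in> {u..v}" "v \<in> {u..v}" using that(3,4) by auto
      then have "u \<in> ball t s" "v \<in> ball t s" using that(5) by blast+
      then have "norm (g u - g t) \<le> (L + \<epsilon>) * (t - u)" "norm (g v - g t) \<le> (L + \<epsilon>) * (v - t)"
        using bound[of u] bound[of v] that by (auto simp: dist_real_def)
      moreover have "norm (g v - g u) \<le> norm (g v - g t) + norm (g u - g t)"
        using norm_triangle_ineq4[of "g v - g t" "g u - g t"] by simp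
      ultimately show ?thesis by (simp add: algebra_simps)
    qed
    with \<open>s > 0\<close> show ?thesis by blast
  qed
  then obtain s where s: "\<And>t. t \<in> {a..b} - Z \<Longrightarrow> s t > 0"
      "\<And>t u v. \<lbrakk>t \<in> {a..b} - Z; u \<in> {a..b}; v \<in> {a..b}; u \<le> t; t \<le> v; {u..v} \<subseteq> ball t (s t)\<rbrakk>
        \<Longrightarrow> norm (g v - g u) \<le> (L + \<epsilon>) * (v - u)"
    by metis
  define \<gamma> where
    "\<gamma> t = (if t \<in> Z then ball t (r t) else if t \<in> {a..b} then ball t (s t) else ball t 1)" for t
  have "gauge \<gamma>"
    unfolding gauge_def \<gamma>_def using r s(1) by auto
  then obtain P where P: "P tagged_division_of {a..b}" "\<gamma> fine P"
    by (rule fine_division_exists_real)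
  note tag = tagged_division_ofD[OF P(1)]
  \<comment> \<open>The case \<open>K = {}\<close> fixes a value where \<open>Sup {}\<close> and \<open>Inf {}\<close> are unspecified;
      converting a sum over tagged intervals into a sum over intervals needs this value to be 0.\<close>
  define incr where "incr K = (if K = {} then 0 else norm (g (Sup K) - g (Inf K)))" for K
  define bad where "bad = {(t, K) \<in> P. t \<in> Z}"
  have elem: "\<exists>u v. K = {u..v} \<and> u \<le> t \<and> t \<le> v \<and> u \<in> {a..b} \<and> v \<in> {a..b}"
    if "(t, K) \<in> P" for t K
    using tag(2)[OF that] tag(3)[OF that] tag(4)[OF that] by fastforce
  have "finite P" "bad \<subseteq> P" using tag(1) by (auto simp: bad_def)
  have len_nonneg: "Sup K - Inf K \<ge> 0" if "(t, K) \<in> P" for t K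
    using elem[OF that] by fastforce
  have good_le: "(\<Sum>(t, K)\<in>P - bad. incr K) \<le> (\<Sum>(t, K)\<in>P - bad. (L + \<epsilon>) * (Sup K - Inf K))"
  proof (rule sum_mono, clarify)
    fix t K assume tK: "(t, K) \<in> P" "(t, K) \<notin> bad"
    then obtain u v where uv: "K = {u..v}" "u \<le> t" "t \<le> v" "u \<in> {a..b}" "v \<in> {a..b}"
      using elem by blast
    have "t \<in> {a..b} - Z" using tK uv by (auto simp: bad_def)
    moreover have "K \<subseteq> ball t (s t)"
      using fineD[OF P(2) tK(1)] \<open>t \<in> {a..b} - Z\<close> by (auto simp: \<gamma>_def)
    ultimately show "incr K \<le> (L + \<epsilon>) * (Sup K - Inf K)"
      using s(2)[of t u v] uv by (simp add: incr_def)
  qed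
  \<comment> \<open>The intervals tagged in \<open>Z\<close> lie in \<open>U\<close>, so their total length is below \<open>\<delta>\<close>.\<close>
  have bad_div: "bad tagged_division_of \<Union> (snd ` bad)"
    using tagged_partial_division_of_Union_self tagged_partial_division_subset[OF _ \<open>bad \<subseteq> P\<close>] P(1)
    by (metis tagged_division_of_def)
  have div: "snd ` bad division_of \<Union> (snd ` bad)"
    using bad_div by (rule division_of_tagged_division)
  have "\<Union> (snd ` bad) \<subseteq> U"
  proof clarsimp
    fix x t K assume *: "(t, K) \<in> bad" "x \<in> K"
    then have "K \<subseteq> ball t (r t)" "t \<in> Z"
      using fineD[OF P(2)] by (force simp: bad_def \<gamma>_def)+
    with r * show "x \<in> U" by blast
  qed
  then have "(\<Sum>K\<in>snd ` bad. Sup K - Inf K) \<le> measure lebesgue U"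
    by (rule sum_lengths_le_measure[OF div _ U(3)])
  with U(4) have "(\<Sum>K\<in>snd ` bad. Sup K - Inf K) < \<delta>" by simp
  moreover have "\<Union> (snd ` bad) \<subseteq> {a..b}"
    using \<open>bad \<subseteq> P\<close> tag(3) by force
  ultimately have "(\<Sum>K\<in>snd ` bad. norm (g (Sup K) - g (Inf K))) < \<epsilon>"
    using \<delta> div by blast
  moreover have "(\<Sum>K\<in>snd ` bad. incr K) = (\<Sum>K\<in>snd ` bad. norm (g (Sup K) - g (Inf K)))"
    by (rule sum.cong) (use division_ofD(3)[OF div] in \<open>auto simp: incr_def\<close>)
  moreover have "(\<Sum>(t, K)\<in>bad. incr K) = (\<Sum>K\<in>snd ` bad. incr K)"
  proof (rule sum.over_tagged_division_lemma[OF bad_div])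
    fix u v :: real
    assume "box u v = {}"
    then have "u = v \<or> cbox u v = {}" by auto
    then show "incr (cbox u v) = 0" by (auto simp: incr_def)
  qed
  ultimately have bad_le: "(\<Sum>(t, K)\<in>bad. incr K) \<le> \<epsilon>" by simp
  have "norm (g b - g a) = norm (\<Sum>(t, K)\<in>P. g (Sup K) - g (Inf K))"
    using additive_tagged_division_1[OF \<open>a \<le> b\<close> P(1), of g] by simp
  also have "\<dots> \<le> (\<Sum>(t, K)\<in>P. incr K)"
    by (rule sum_norm_le) (use elem in \<open>fastforce simp: incr_def\<close>)
  also have "\<dots> = (\<Sum>(t, K)\<in>P - bad. incr K) + (\<Sum>(t, K)\<in>bad. incr K)"
    by (rule sum.subset_diff[OF \<open>bad \<subseteq> P\<close> \<open>finite P\<close>])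
  also have "\<dots> \<le> (\<Sum>(t, K)\<in>P - bad. (L + \<epsilon>) * (Sup K - Inf K)) + \<epsilon>"
    using good_le bad_le by (rule add_mono)
  also have "(\<Sum>(t, K)\<in>P - bad. (L + \<epsilon>) * (Sup K - Inf K)) \<le> (\<Sum>(t, K)\<in>P. (L + \<epsilon>) * (Sup K - Inf K))"
    by (rule sum_mono2) (use \<open>finite P\<close> \<open>0 \<le> L\<close> \<epsilon>(1) len_nonneg in \<open>auto intro!: mult_nonneg_nonneg\<close>)
  also have "\<dots> = (L + \<epsilon>) * (b - a)"
    using additive_tagged_division_1[OF \<open>a \<le> b\<close> P(1), of "\<lambda>x. x"]
    by (simp add: sum_distrib_left[symmetric] case_prod_unfold)
  finally show "norm (g b - g a) \<le> L * (b - a) + e"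
    using \<epsilon>(2) by (simp add: algebra_simps)
qed

section \<open>Stability properties of absolute continuity\<close>

lemma absolutely_continuous_on_interval_subset:
  assumes "absolutely_continuous_on_interval a b g" "{c..d} \<subseteq> {a..b}"
  shows "absolutely_continuous_on_interval c d g"
  using assms unfolding absolutely_continuous_on_interval_def by (meson order_trans)

lemma absolutely_continuous_on_interval_imp_continuous_on:
  assumes ac: "absolutely_continuous_on_interval a b g"
  shows "continuous_on {a..b} g"
  unfolding continuous_on_iff
proof (intro ballI allI impI)
  fix x e :: real assume "x \<in> {a..b}" "e > 0"
  obtain \<delta> where "\<delta> > 0" and \<delta>: "\<And>D S. \<lbrakk>D division_of S; S \<subseteq> {a..b}; (\<Sum>K\<in>D. Sup K - Inf K) < \<delta>\<rbrakk>
      \<Longrightarrow> (\<Sum>K\<in>D. norm (g (Sup K) - g (Inf K))) < e"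
    using ac \<open>e > 0\<close> unfolding absolutely_continuous_on_interval_def by meson
  have small: "norm (g v - g u) < e" if "a \<le> u" "u \<le> v" "v \<le> b" "v - u < \<delta>" for u v
    using \<delta>[of "{{u..v}}" "{u..v}"] division_of_self[of u v] that by simp
  have "dist (g y) (g x) < e" if "y \<in> {a..b}" "dist y x < \<delta>" for y
  proof (cases "x \<le> y")
    case True
    then show ?thesis using small[of x y] that \<open>x \<in> {a..b}\<close> by (simp add: dist_norm)
  next
    case False
    then show ?thesis using small[of y x] that \<open>x \<in> {a..b}\<close> by (simp add: dist_norm norm_minus_commute)
  qed
  with \<open>\<delta> > 0\<close> show "\<exists>d>0. \<forall>x'\<in>{a..b}. dist x' x < d \<longrightarrow> dist (g x') (g x) < e"
    by blast
qed

lemma absolutely_continuous_on_interval_diff: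
  assumes "absolutely_continuous_on_interval a b g" "absolutely_continuous_on_interval a b h"
  shows "absolutely_continuous_on_interval a b (\<lambda>t. g t - h t)"
  unfolding absolutely_continuous_on_interval_def
proof (intro allI impI)
  fix e :: real assume "e > 0"
  obtain \<delta>1 where "\<delta>1 > 0" and \<delta>1: "\<And>D S. \<lbrakk>D division_of S; S \<subseteq> {a..b}; (\<Sum>K\<in>D. Sup K - Inf K) < \<delta>1\<rbrakk>
      \<Longrightarrow> (\<Sum>K\<in>D. norm (g (Sup K) - g (Inf K))) < e / 2"
    using assms(1) half_gt_zero[OF \<open>e > 0\<close>] unfolding absolutely_continuous_on_interval_def by meson
  obtain \<delta>2 where "\<delta>2 > 0" and \<delta>2: "\<And>D S. \<lbrakk>D division_of S; S \<subseteq> {a..b}; (\<Sum>K\<in>D. Sup K - Inf K) < \<delta>2\<rbrakk>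
      \<Longrightarrow> (\<Sum>K\<in>D. norm (h (Sup K) - h (Inf K))) < e / 2"
    using assms(2) half_gt_zero[OF \<open>e > 0\<close>] unfolding absolutely_continuous_on_interval_def by meson
  have "(\<Sum>K\<in>D. norm (g (Sup K) - h (Sup K) - (g (Inf K) - h (Inf K)))) < e"
    if "D division_of S" "S \<subseteq> {a..b}" "(\<Sum>K\<in>D. Sup K - Inf K) < min \<delta>1 \<delta>2" for D S
  proof -
    have "(\<Sum>K\<in>D. norm (g (Sup K) - h (Sup K) - (g (Inf K) - h (Inf K))))
        \<le> (\<Sum>K\<in>D. norm (g (Sup K) - g (Inf K)) + norm (h (Sup K) - h (Inf K)))"
    proof (rule sum_mono)
      fix K
      show "norm (g (Sup K) - h (Sup K) - (g (Inf K) - h (Inf K)))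
          \<le> norm (g (Sup K) - g (Inf K)) + norm (h (Sup K) - h (Inf K))"
        using norm_triangle_ineq4[of "g (Sup K) - g (Inf K)" "h (Sup K) - h (Inf K)"]
        by (simp add: algebra_simps)
    qed
    also have "\<dots> < e"
      using \<delta>1[OF that(1,2)] \<delta>2[OF that(1,2)] that(3) by (simp add: sum.distrib)
    finally show ?thesis .
  qed
  then show "\<exists>\<delta>>0. \<forall>D S. D division_of S \<longrightarrow> S \<subseteq> {a..b} \<longrightarrow> (\<Sum>K\<in>D. Sup K - Inf K) < \<delta> \<longrightarrow>
      (\<Sum>K\<in>D. norm (g (Sup K) - h (Sup K) - (g (Inf K) - h (Inf K)))) < e"
    using \<open>\<delta>1 > 0\<close> \<open>\<delta>2 > 0\<close> by (intro exI[of _ "min \<delta>1 \<delta>2"]) auto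
qed

lemma absolutely_continuous_on_interval_bounded_linear:
  assumes "bounded_linear h" and ac: "absolutely_continuous_on_interval a b g"
  shows "absolutely_continuous_on_interval a b (\<lambda>t. h (g t))"
  unfolding absolutely_continuous_on_interval_def
proof (intro allI impI)
  fix e :: real assume "e > 0"
  obtain B where "B > 0" and B: "\<And>x. norm (h x) \<le> norm x * B"
    using bounded_linear.pos_bounded[OF assms(1)] by blast
  have "e / B > 0" using \<open>e > 0\<close> \<open>B > 0\<close> by simp
  then obtain \<delta> where "\<delta> > 0" and \<delta>: "\<And>D S. \<lbrakk>D division_of S; S \<subseteq> {a..b}; (\<Sum>K\<in>D. Sup K - Inf K) < \<delta>\<rbrakk>
      \<Longrightarrow> (\<Sum>K\<in>D. norm (g (Sup K) - g (Inf K))) < e / B"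
    using ac unfolding absolutely_continuous_on_interval_def by meson
  have "(\<Sum>K\<in>D. norm (h (g (Sup K)) - h (g (Inf K)))) < e"
    if "D division_of S" "S \<subseteq> {a..b}" "(\<Sum>K\<in>D. Sup K - Inf K) < \<delta>" for D S
  proof -
    have "(\<Sum>K\<in>D. norm (h (g (Sup K)) - h (g (Inf K)))) \<le> (\<Sum>K\<in>D. norm (g (Sup K) - g (Inf K)) * B)"
      by (rule sum_mono) (use B linear_diff[OF bounded_linear.linear[OF assms(1)]] in metis)
    also have "\<dots> = (\<Sum>K\<in>D. norm (g (Sup K) - g (Inf K))) * B"
      by (simp add: sum_distrib_right)
    also have "\<dots> < e"
      using \<delta>[OF that] \<open>B > 0\<close> by (simp add: pos_less_divide_eq)
    finally show ?thesis .
  qed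
  with \<open>\<delta> > 0\<close> show "\<exists>\<delta>>0. \<forall>D S. D division_of S \<longrightarrow> S \<subseteq> {a..b} \<longrightarrow> (\<Sum>K\<in>D. Sup K - Inf K) < \<delta> \<longrightarrow>
      (\<Sum>K\<in>D. norm (h (g (Sup K)) - h (g (Inf K)))) < e"
    by blast
qed

section \<open>Uniqueness for linear equations that hold almost everywhere\<close>

text \<open>
  On an interval of length \<open>h = 1 / (2 * L')\<close> that starts at a zero of \<open>g\<close>, the maximum \<open>M\<close> of
  the norm of \<open>g\<close> satisfies \<open>M \<le> L' * M * h = M / 2\<close>, so \<open>g\<close> vanishes there. Since \<open>h\<close> does not
  depend on the interval, finitely many such steps reach any given time.
\<close>

lemma locally_absolutely_continuous_eq_zero:
  fixes g :: "real \<Rightarrow> 'a::real_normed_vector"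
  assumes lac: "locally_absolutely_continuous g"
    and der: "AE t in lebesgue_on {0..}.
       \<exists>D. (g has_vector_derivative D) (at t within {0..}) \<and> norm D \<le> L * norm (g t)"
    and "g 0 = 0" and "t \<ge> 0"
  shows "g t = 0"
proof -
  obtain Z where Z: "negligible Z" and der_Z: "\<And>t. t \<in> {0..} - Z \<Longrightarrow>
      \<exists>D. (g has_vector_derivative D) (at t within {0..}) \<and> norm D \<le> L * norm (g t)"
  proof -
    have "AE t in lebesgue. t \<in> {0..} \<longrightarrow>
        (\<exists>D. (g has_vector_derivative D) (at t within {0..}) \<and> norm D \<le> L * norm (g t))"
      using der by (subst (asm) AE_restrict_space_iff) auto
    then show thesis
      using that unfolding eventually_ae_filter negligible_iff_null_sets by fastforce
  qed
  \<comment> \<open>Enlarging \<open>L\<close> to a positive constant lets \<open>h\<close> be defined by division.\<close>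
  define L' where "L' = max L 1"
  define h where "h = 1 / (2 * L')"
  have "L' > 0" "h > 0" "L \<le> L'" by (auto simp: L'_def h_def)
  have zero: "\<forall>s \<in> {0..real n * h}. g s = 0" for n
  proof (induction n)
    case 0
    then show ?case using \<open>g 0 = 0\<close> by simp
  next
    case (Suc n)
    define a where "a = real n * h"
    have "a \<ge> 0" "a + h = real (Suc n) * h"
      using \<open>h > 0\<close> by (auto simp: a_def algebra_simps)
    have "g a = 0" using Suc \<open>a \<ge> 0\<close> by (simp add: a_def)
    have "absolutely_continuous_on_interval 0 (a + h) g"
      using lac \<open>a \<ge> 0\<close> \<open>h > 0\<close> by (simp add: locally_absolutely_continuous_def)
    then have ac: "absolutely_continuous_on_interval a c g" if "c \<le> a + h" for c
      by (rule absolutely_continuous_on_interval_subset) (use \<open>a \<ge> 0\<close> that in auto)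
    have "continuous_on {a..a + h} (\<lambda>t. norm (g t))"
      by (intro continuous_on_norm absolutely_continuous_on_interval_imp_continuous_on ac order_refl)
    moreover have "{a..a + h} \<noteq> {}" using \<open>h > 0\<close> by simp
    ultimately obtain c where c: "c \<in> {a..a + h}" "\<And>s. s \<in> {a..a + h} \<Longrightarrow> norm (g s) \<le> norm (g c)"
      using continuous_attains_sup[OF compact_Icc] by metis
    have "norm (g c - g a) \<le> (L' * norm (g c)) * (c - a)"
    proof (rule absolutely_continuous_increment_bound[OF _ _ _ Z])
      fix s assume s: "s \<in> {a..c} - Z"
      then obtain D where D: "(g has_vector_derivative D) (at s within {0..})" "norm D \<le> L * norm (g s)"
        using der_Z[of s] \<open>a \<ge> 0\<close> by auto
      have "norm D \<le> L' * norm (g c)"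
        using D(2) c(2)[of s] s c(1) \<open>L \<le> L'\<close> \<open>L' > 0\<close>
        by (meson DiffD1 atLeastAtMost_iff less_imp_le mult_left_mono mult_right_mono norm_ge_zero order_trans)
      moreover have "(g has_vector_derivative D) (at s within {a..c})"
        using D(1) by (rule has_vector_derivative_within_subset) (use \<open>a \<ge> 0\<close> in auto)
      ultimately show "\<exists>D. (g has_vector_derivative D) (at s within {a..c}) \<and> norm D \<le> L' * norm (g c)"
        by blast
    qed (use ac c(1) \<open>L' > 0\<close> in auto)
    also have "\<dots> \<le> (L' * norm (g c)) * h"
      using c(1) \<open>L' > 0\<close> by (intro mult_left_mono) auto
    also have "\<dots> = norm (g c) / 2"
      using \<open>L' > 0\<close> by (simp add: h_def)
    finally have "norm (g c) = 0" using \<open>g a = 0\<close> by simp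
    then have "g s = 0" if "s \<in> {a..a + h}" for s
      using c(2)[OF that] by simp
    moreover have "{0..real (Suc n) * h} \<subseteq> {0..real n * h} \<union> {a..a + h}"
      using \<open>a + h = _\<close> by (auto simp: a_def)
    ultimately show ?case using Suc by blast
  qed
  obtain n where "t \<le> real n * h"
    using \<open>h > 0\<close> reals_Archimedean3[of h] less_imp_le by metis
  with zero[of n] \<open>t \<ge> 0\<close> show ?thesis by simp
qed

section \<open>Trajectories that follow a fixed policy\<close>

lemma S_policy_nth: "(S_policy \<pi> *v v) $ q = v $ \<pi> q"
  by (simp add: S_policy_def matrix_vector_mult_def if_distrib[of "\<lambda>c. c * _"] cong: if_cong)

text \<open>
  Selecting places commutes with dividing by their time constants: \<open>policy_rate\<close> is the operator on
  vectors indexed by transitions that corresponds to \<open>over_tau\<close>. This is what lets the equation for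
  the selected places close up.
\<close>

definition policy_rate :: "('p::finite, 'q::finite) petri_net \<Rightarrow> ('q \<Rightarrow> 'p) \<Rightarrow> real^'q \<Rightarrow> real^'q" where
  "policy_rate N \<pi> x = (\<chi> q. x $ q / tau N (\<pi> q))"

lemma linear_policy_rate: "linear (policy_rate N \<pi>)"
  by (rule linearI) (simp_all add: policy_rate_def vec_eq_iff add_divide_distrib)

lemma S_policy_over_tau: "S_policy \<pi> *v over_tau N v = policy_rate N \<pi> (S_policy \<pi> *v v)"
  by (simp add: vec_eq_iff S_policy_nth policy_rate_def over_tau_def)

text \<open>
  The difference \<open>g\<close> of the two vectors \<open>S_policy \<pi> *v m\<close> and \<open>S_policy \<pi> *v m'\<close> solves the
  linear equation \<open>g' = G g\<close> almost everywhere. It vanishes at time 0 because selected places hold no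
  waiting tokens, so that equal markings mean equal quantities under processing there.
\<close>

theorem flow_determined_by_policy:
  fixes N :: "('p::finite, 'q::finite) petri_net"
  assumes traj: "trajectory N m w f" "trajectory N m' w' f'"
    and reach: "\<forall>t\<ge>0. reaches_infimum N \<pi> m w f t" "\<forall>t\<ge>0. reaches_infimum N \<pi> m' w' f' t"
    and init: "marking m w 0 = marking m' w' 0"
    and "t \<ge> 0"
  shows "f t = f' t"
proof -
  define S where "S = (S_policy \<pi> :: real^'p^'q)"
  define J where "J = matrix_inv (C_minus_policy N \<pi>)"
  define g where "g t = S *v (m t - m' t)" for t
  define G where "G x = S *v (C_plus N *v (J *v policy_rate N \<pi> x)) - policy_rate N \<pi> x" for x
  have flow: "f t - f' t = J *v policy_rate N \<pi> (g t)" if "t \<ge> 0" for t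
  proof -
    have "f t = J *v policy_rate N \<pi> (S *v m t)" "f' t = J *v policy_rate N \<pi> (S *v m' t)"
      using reach that by (auto simp: reaches_infimum_def S_policy_over_tau J_def S_def)
    then show ?thesis
      by (simp add: g_def matrix_vector_mult_diff_distrib linear_diff[OF linear_policy_rate])
  qed
  have "g 0 = 0"
  proof -
    have "S *v w 0 = 0" "S *v w' 0 = 0"
      using reach by (auto simp: reaches_infimum_def S_def)
    moreover have "S *v (m 0 + w 0) = S *v (m' 0 + w' 0)"
      using init by (simp add: marking_def)
    ultimately show ?thesis
      by (simp add: g_def matrix_vector_mult_diff_distrib matrix_vector_right_distrib)
  qed
  have "linear G"
    by (rule linearI)
      (simp_all add: G_def linear_add[OF linear_policy_rate] linear_cmul[OF linear_policy_rate]
        matrix_vector_right_distrib matrix_vector_mult_scaleR scaleR_right_diff_distrib)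
  then obtain L where L: "\<And>x. norm (G x) \<le> L * norm x"
    using linear_bounded by blast
  have bl: "bounded_linear ((*v) S)" by simp
  have "g t = 0" if "t \<ge> 0" for t
  proof (rule locally_absolutely_continuous_eq_zero[where g = g, OF _ _ \<open>g 0 = 0\<close> that])
    show "locally_absolutely_continuous g"
      using traj unfolding locally_absolutely_continuous_def g_def trajectory_def
      by (intro allI impI absolutely_continuous_on_interval_bounded_linear[OF bl]
          absolutely_continuous_on_interval_diff) auto
    have "AE t in lebesgue_on {0..}.
        (m has_vector_derivative (C_plus N *v f t - over_tau N (m t))) (at t within {0..})"
      "AE t in lebesgue_on {0..}.
        (m' has_vector_derivative (C_plus N *v f' t - over_tau N (m' t))) (at t within {0..})"
      "AE t in lebesgue_on {0..}. t \<ge> 0"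
      using traj by (auto simp: trajectory_def AE_restrict_space_iff)
    then show "AE t in lebesgue_on {0..}.
        \<exists>D. (g has_vector_derivative D) (at t within {0..}) \<and> norm D \<le> L * norm (g t)"
    proof eventually_elim
      case (elim t)
      have "(g has_vector_derivative S *v ((C_plus N *v f t - over_tau N (m t)) -
          (C_plus N *v f' t - over_tau N (m' t)))) (at t within {0..})"
        unfolding g_def
        by (intro bounded_linear.has_vector_derivative[OF bl] has_vector_derivative_diff elim)
      also have "S *v ((C_plus N *v f t - over_tau N (m t)) -
          (C_plus N *v f' t - over_tau N (m' t))) = G (g t)"
      proof -
        have "G (g t) = S *v (C_plus N *v (f t - f' t)) - policy_rate N \<pi> (g t)"
          using flow[OF elim(3)] by (simp add: G_def)
        also have "policy_rate N \<pi> (g t) = S *v over_tau N (m t) - S *v over_tau N (m' t)"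
          by (simp add: g_def S_def S_policy_over_tau matrix_vector_mult_diff_distrib
              linear_diff[OF linear_policy_rate])
        finally show ?thesis
          by (simp add: matrix_vector_mult_diff_distrib algebra_simps)
      qed
      finally show ?case using L by blast
    qed
  qed
  with flow[OF \<open>t \<ge> 0\<close>] \<open>t \<ge> 0\<close> show ?thesis
    by (simp add: linear_0[OF linear_policy_rate])
qed

theorem theorem7:
  fixes N :: "('p::finite, 'q::finite) petri_net"
    and \<pi> :: "'q \<Rightarrow> 'p"
    and m w m' w' :: "real \<Rightarrow> real^'p"
    and f f' :: "real \<Rightarrow> real^'q"
    and m_lim m'_lim :: "real^'p"
    and w_lim w'_lim :: "real \<Rightarrow> real^'p"
    and f_lim f'_lim :: "real^'q"
  assumes "priority_free_choice_net N"
    and "policy N \<pi>"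
    and "semisimple_eigenvalue (S_policy \<pi> ** C_plus N - C_minus_policy N \<pi>) 0"
    and "trajectory N m w f"
    and "converges_to_stationary N m w f m_lim w_lim f_lim"
    and "\<forall>t\<ge>0. reaches_infimum N \<pi> m w f t"
    and "trajectory N m' w' f'"
    and "converges_to_stationary N m' w' f' m'_lim w'_lim f'_lim"
    and "\<forall>t\<ge>0. reaches_infimum N \<pi> m' w' f' t"
    and "marking m w 0 = marking m' w' 0"
  shows "f_lim = f'_lim"
proof -
  have "f t = f' t" if "t \<ge> 0" for t
    using flow_determined_by_policy[OF assms(4,7,6,9,10) that] .
  then have "eventually (\<lambda>t. f t = f' t) at_top"
    using eventually_ge_at_top[of "0::real"] by (rule eventually_mono[rotated])
  moreover have "(f \<longlongrightarrow> f_lim) at_top" "(f' \<longlongrightarrow> f'_lim) at_top"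
    using assms(5,8) by (auto simp: converges_to_stationary_def)
  ultimately show ?thesis
    by (metis tendsto_cong tendsto_unique trivial_limit_at_top_linorder)
qed

end
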